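(* Let $G$ be a non-amenable group and let $A$ be a finite generating set for $G$. For $n\in\mathbb{N}$ let $B_n$ be the closed ball of radius $n$ about the identity in $G$ with respect to $A$, and for $m\in\mathbb{N}$ let $D_m$ be the set of elements of $G$ of depth at least $m$ with respect to $A$. Then there are real numbers $c>0$ and $0<b<1$ such that, for all $m\in\mathbb{N}$, $$\limsup_{n\to\infty}\frac{|B_n\cap D_m|}{|B_n|}<cb^m.$$
   Context: Let $G$ be a group with finite generating set $A$, and let $d_A$ be the word metric on $G$ with respect to $A$, i.e. $d_A(g,h)$ is the least length of a word in $A\cup A^{-1}$ representing $g^{-1}h$. The closed ball of radius $n$ about the identity is $B_n=\{g\in G: d_A(1,g)\le n\}$. The depth (dead-end depth) of $g\in G$ with respect to $A$ is the distance, in the metric $d_A$, from $g$ to the complement in $G$ of the closed ball of radius $d_A(1,g)$ about the identity. The constants $c$ and $b$ may depend on $G$ and $A$ but not on $m$. *)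

theory Defs
  imports
    "HOL-Algebra.Generated_Groups"
    "HOL-Library.Extended_Real"
    "HOL-Library.Liminf_Limsup"
begin

text \<open>
  Amenability of a discrete group: there is a finitely additive, left-invariant probability
  measure defined on all subsets of the group.
\<close>

definition amenable :: "('a, 'b) monoid_scheme \<Rightarrow> bool" where
  "amenable G \<longleftrightarrow>
     (\<exists>\<mu> :: 'a set \<Rightarrow> real.
        (\<forall>S. S \<subseteq> carrier G \<longrightarrow> 0 \<le> \<mu> S) \<and>
        \<mu> (carrier G) = 1 \<and>
        (\<forall>S T. S \<subseteq> carrier G \<and> T \<subseteq> carrier G \<and> S \<inter> T = {} \<longrightarrow> \<mu> (S \<union> T) = \<mu> S + \<mu> T) \<and>
        (\<forall>g S. g \<in> carrier G \<and> S \<subseteq> carrier G \<longrightarrow> \<mu> (g <#\<^bsub>G\<^esub> S) = \<mu> S))"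

definition word_value :: "('a, 'b) monoid_scheme \<Rightarrow> 'a list \<Rightarrow> 'a" where
  "word_value G w = foldr (\<otimes>\<^bsub>G\<^esub>) w \<one>\<^bsub>G\<^esub>"

definition words_over :: "('a, 'b) monoid_scheme \<Rightarrow> 'a set \<Rightarrow> 'a list set" where
  "words_over G A = lists (A \<union> m_inv G ` A)"

text \<open>
  The least length below exists, and hence the value is meaningful, whenever \<open>A\<close> generates
  \<open>G\<close> and both points lie in the carrier.
\<close>

definition word_dist :: "('a, 'b) monoid_scheme \<Rightarrow> 'a set \<Rightarrow> 'a \<Rightarrow> 'a \<Rightarrow> nat" where
  "word_dist G A g h =
     (LEAST n. \<exists>w \<in> words_over G A. length w = n \<and> word_value G w = inv\<^bsub>G\<^esub> g \<otimes>\<^bsub>G\<^esub> h)"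

definition word_ball :: "('a, 'b) monoid_scheme \<Rightarrow> 'a set \<Rightarrow> nat \<Rightarrow> 'a set" where
  "word_ball G A n = {g \<in> carrier G. word_dist G A \<one>\<^bsub>G\<^esub> g \<le> n}"

text \<open>
  The depth is \<open>\<infinity>\<close> exactly if the ball of radius \<open>word_dist G A \<one> g\<close> is all of \<open>G\<close>, which
  can only happen if \<open>G\<close> is finite (for finite \<open>A\<close>).
\<close>

definition depth :: "('a, 'b) monoid_scheme \<Rightarrow> 'a set \<Rightarrow> 'a \<Rightarrow> enat" where
  "depth G A g =
     (INF h \<in> carrier G - word_ball G A (word_dist G A \<one>\<^bsub>G\<^esub> g). enat (word_dist G A g h))"

definition deep_elements :: "('a, 'b) monoid_scheme \<Rightarrow> 'a set \<Rightarrow> nat \<Rightarrow> 'a set" where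
  "deep_elements G A m = {g \<in> carrier G. enat m \<le> depth G A g}"

end

theory Submission imports Defs "HOL-Analysis.Function_Topology" begin

text \<open>
  The set \<open>S\<close> of elements of \<open>B\<^sub>n\<close> of depth at least \<open>m\<close> lies far inside \<open>B\<^sub>n\<close>: an
  element at distance less than \<open>m\<close> from some \<open>g \<in> S\<close> cannot leave the ball whose radius is the
  length of \<open>g\<close>, so it still belongs to \<open>B\<^sub>n\<close>. Hence all products \<open>g a\<^sub>1 \<cdots> a\<^sub>k\<close> with
  \<open>g \<in> S\<close>, \<open>k < m\<close> and \<open>a\<^sub>i \<in> A\<close> are in \<open>B\<^sub>n\<close> (\<open>thickening_deep_subset_ball\<close>).

  In a non-amenable group every finite set grows by a factor of at least some fixed \<open>1 + \<epsilon>\<close>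
  when it is multiplied on the right by \<open>A \<union> {1}\<close> (\<open>nonamenable_expansion\<close>). For \<open>m > 0\<close>, doing
  this \<open>m - 1\<close> times gives \<open>(1 + \<epsilon>)\<^bsup>m - 1\<^esup> |S| \<le> |B\<^sub>n|\<close> for every \<open>n\<close>, and the limsup inherits
  the bound; doubling the constant makes the inequality strict.

  The expansion property is one half of the Folner criterion. Without it there are finite sets
  \<open>S\<^sub>k\<close> that are less and less affected by right multiplication with the generators, and a limit
  of the uniform probability measures on the sets \<open>S\<^sub>k\<^sup>-\<^sup>1\<close> is an invariant mean
  (\<open>amenable_if_no_expansion\<close>). Inverses appear because expansion is about right multiplication
  whereas the mean has to be invariant on the left. The limit exists by Tychonoff's theorem
  (\<open>convergent_subfilter_of_bounded\<close>).
\<close>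

section \<open>Invariant means from failing expansion\<close>

text \<open>
  A substitute for an ultrafilter limit: the values lie in a compact cube, which has a cluster
  point, and restricting to preimages of its neighbourhoods forces convergence. Along the filter
  \<open>F\<close> all coordinates converge at once, so that limits of finitely many coordinates can be compared
  by the usual rules.
\<close>

lemma convergent_subfilter_of_bounded:
  fixes f :: "'k \<Rightarrow> 'i \<Rightarrow> real"
  assumes bounded: "\<And>k i. f k i \<in> {a..b}" and "G \<noteq> bot"
  obtains F L where "F \<noteq> bot" "F \<le> G" "\<And>i. ((\<lambda>k. f k i) \<longlongrightarrow> L i) F"
proof -
  let ?K = "PiE UNIV (\<lambda>i::'i. {a..b})"
  have "compactin (product_topology (\<lambda>i. euclidean) UNIV) ?K"
    by (simp add: compactin_PiE)
  hence "compact ?K"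
    by (simp add: euclidean_product_topology)
  moreover have "filtermap f G \<noteq> bot"
    using \<open>G \<noteq> bot\<close> by (simp add: filtermap_bot_iff)
  moreover have "eventually (\<lambda>g. g \<in> ?K) (filtermap f G)"
    using bounded by (simp add: eventually_filtermap PiE_iff)
  ultimately obtain L where L: "inf (nhds L) (filtermap f G) \<noteq> bot"
    unfolding compact_filter by blast
  define F where "F = inf G (filtercomap f (nhds L))"
  have "F \<noteq> bot"
  proof
    assume "F = bot"
    hence "eventually (\<lambda>_. False) (inf G (filtercomap f (nhds L)))"
      by (simp add: F_def trivial_limit_def)
    then obtain P Q where P: "eventually P G" and Q: "eventually Q (nhds L)"
      and PQ: "\<forall>k. P k \<longrightarrow> \<not> Q (f k)"
      unfolding eventually_inf eventually_filtercomap by blast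
    have "eventually (\<lambda>k. \<not> Q (f k)) G"
      by (rule eventually_mono[OF P]) (use PQ in blast)
    hence "eventually (\<lambda>g. \<not> Q g) (filtermap f G)"
      by (simp add: eventually_filtermap)
    hence "inf (nhds L) (filtermap f G) = bot"
      using Q unfolding trivial_limit_def eventually_inf by blast
    with L show False by simp
  qed
  moreover have "F \<le> G" by (simp add: F_def)
  moreover have "((\<lambda>k. f k i) \<longlongrightarrow> L i) F" for i
  proof -
    have "(f \<longlongrightarrow> L) F"
      by (simp add: F_def filterlim_iff_le_filtercomap)
    have coordinate: "continuous_on UNIV (\<lambda>g::'i \<Rightarrow> real. g i)"
      by (rule continuous_on_product_then_coordinatewise[OF continuous_on_id])
    show ?thesis
      by (rule continuous_on_tendsto_compose[OF coordinate \<open>(f \<longlongrightarrow> L) F\<close>]) auto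
  qed
  ultimately show ?thesis by (rule that)
qed

text \<open>
  The Folner argument: counting \<open>s \<in> S\<^sub>k\<close> with \<open>s\<^sup>-\<^sup>1 \<in> T\<close> gives probability measures for which
  a left translation of \<open>T\<close> by a generator amounts to a right translation of \<open>S\<^sub>k\<close>, and the latter
  moves less than a fraction \<open>1/(k + 1)\<close> of the points out of \<open>S\<^sub>k\<close>. Every limit is therefore invariant
  under the generators, hence under the group. The strict inequality keeps \<open>S\<close>
  from being empty.
\<close>

lemma amenable_if_no_expansion:
  fixes G (structure)
  assumes "group G" and "finite A" and A: "A \<subseteq> carrier G" and gen: "generate G A = carrier G"
    and no_expansion: "\<And>\<epsilon>::real. \<epsilon> > 0 \<Longrightarrow>
      \<exists>S \<subseteq> carrier G. finite S \<and> card (S <#> insert \<one> A) < (1 + \<epsilon>) * card S"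
  shows "amenable G"
proof -
  interpret group G by fact
  let ?B = "insert \<one> A"
  have "\<exists>S. S \<subseteq> carrier G \<and> finite S \<and> card (S <#> ?B) < (1 + 1 / real (Suc k)) * card S" for k
    using no_expansion[of "1 / real (Suc k)"] by auto
  then obtain S where S: "\<And>k. S k \<subseteq> carrier G" and fin: "\<And>k. finite (S k)"
    and small: "\<And>k. card (S k <#> ?B) < (1 + 1 / real (Suc k)) * card (S k)"
    by metis
  have pos: "card (S k) > 0" for k
    using small[of k] by (cases "card (S k) = 0") auto
  define f where "f k T = card {s \<in> S k. inv s \<in> T} / card (S k)" for k T
  have "card {s \<in> S k. inv s \<in> T} \<le> card (S k)" for k T
    using fin by (intro card_mono) auto
  hence "f k T \<in> {0..1}" for k T
    using pos[of k] by (simp add: f_def divide_le_eq)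
  then obtain F \<mu> where F: "F \<noteq> bot" "F \<le> sequentially"
    and lim: "\<And>T. ((\<lambda>k. f k T) \<longlongrightarrow> \<mu> T) F"
    by (metis convergent_subfilter_of_bounded sequentially_bot)
  have nonneg: "0 \<le> \<mu> T" for T
    by (rule tendsto_lowerbound[OF lim _ F(1)]) (simp add: f_def)
  have total: "\<mu> (carrier G) = 1"
  proof -
    have "{s \<in> S k. inv s \<in> carrier G} = S k" for k
      using S by auto
    hence "f k (carrier G) = 1" for k
      using pos[of k] by (simp add: f_def)
    thus ?thesis
      using tendsto_unique[OF F(1) lim[of "carrier G"], of 1] by simp
  qed
  have additive: "\<mu> (T \<union> U) = \<mu> T + \<mu> U" if "T \<inter> U = {}" for T U
  proof -
    have "f k (T \<union> U) = f k T + f k U" for k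
    proof -
      have "{s \<in> S k. inv s \<in> T \<union> U} = {s \<in> S k. inv s \<in> T} \<union> {s \<in> S k. inv s \<in> U}"
        by auto
      moreover have "card \<dots> = card {s \<in> S k. inv s \<in> T} + card {s \<in> S k. inv s \<in> U}"
        using fin that by (intro card_Un_disjoint) auto
      ultimately show ?thesis
        by (simp add: f_def add_divide_distrib)
    qed
    hence "((\<lambda>k. f k (T \<union> U)) \<longlongrightarrow> \<mu> T + \<mu> U) F"
      by (simp add: tendsto_add lim)
    thus ?thesis
      using tendsto_unique[OF F(1) lim] by blast
  qed
  \<comment> \<open>If \<open>s\<close> is counted for \<open>a T\<close>, then \<open>s a\<close> would be counted for \<open>T\<close>, except that it may lie
      outside \<open>S\<^sub>k\<close>; the few new points of \<open>S\<^sub>k (A \<union> {1})\<close> bound the loss.\<close>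
  have f_translate: "f k (a <# T) \<le> f k T + 1 / real (Suc k)"
    if a: "a \<in> A" and T: "T \<subseteq> carrier G" for k a T
  proof -
    let ?N = "(S k <#> ?B) - S k"
    have aG: "a \<in> carrier G" using a A by auto
    have finB: "finite (S k <#> ?B)"
      using fin \<open>finite A\<close> by (auto simp: set_mult_def)
    have sub: "S k \<subseteq> S k <#> ?B"
      using S[of k] by (force simp: set_mult_def)
    have "(\<lambda>s. s \<otimes> a) ` {s \<in> S k. inv s \<in> a <# T} \<subseteq> {s \<in> S k. inv s \<in> T} \<union> ?N"
    proof clarify
      fix s assume s: "s \<in> S k" "inv s \<in> a <# T" "s \<otimes> a \<notin> ?N"
      have sG: "s \<in> carrier G" using s S by auto
      obtain t where t: "t \<in> T" "inv s = a \<otimes> t"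
        using s(2) by (auto simp: l_coset_def)
      have "inv (s \<otimes> a) = inv a \<otimes> (a \<otimes> t)"
        using sG aG t by (simp add: inv_mult_group)
      also have "\<dots> = t"
        using aG t T by (metis inv_solve_left subsetD m_closed)
      finally have "inv (s \<otimes> a) \<in> T" using t by simp
      moreover have "s \<otimes> a \<in> S k <#> ?B"
        using s a by (auto simp: set_mult_def)
      ultimately show "s \<otimes> a \<in> S k \<and> inv (s \<otimes> a) \<in> T"
        using s(3) by auto
    qed
    moreover have "inj_on (\<lambda>s. s \<otimes> a) {s \<in> S k. inv s \<in> a <# T}"
      using S[of k] aG by (intro inj_onI) (auto simp: subset_iff)
    ultimately have "card {s \<in> S k. inv s \<in> a <# T} \<le> card ({s \<in> S k. inv s \<in> T} \<union> ?N)"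
      using fin finB by (intro card_inj_on_le) auto
    also have "\<dots> \<le> card {s \<in> S k. inv s \<in> T} + card ?N"
      by (rule card_Un_le)
    finally have "real (card {s \<in> S k. inv s \<in> a <# T})
        \<le> card {s \<in> S k. inv s \<in> T} + real (card ?N)"
      by linarith
    moreover have "real (card ?N) = real (card (S k <#> ?B)) - card (S k)"
      using sub finB fin by (simp add: card_Diff_subset card_mono of_nat_diff)
    moreover have "\<dots> \<le> (1 / real (Suc k)) * card (S k)"
      using small[of k] by (simp add: algebra_simps)
    ultimately have "real (card {s \<in> S k. inv s \<in> a <# T})
        \<le> card {s \<in> S k. inv s \<in> T} + (1 / real (Suc k)) * card (S k)"
      by linarith
    thus ?thesis
      using pos[of k] by (simp add: f_def field_simps del: of_nat_Suc)
  qed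
  have le: "\<mu> (a <# T) \<le> \<mu> T" if "a \<in> A" "T \<subseteq> carrier G" for a T
  proof -
    have "((\<lambda>k. 1 / real (Suc k)) \<longlongrightarrow> 0) F"
      using LIMSEQ_inverse_real_of_nat F(2) by (simp add: inverse_eq_divide tendsto_mono)
    hence "((\<lambda>k. f k T + 1 / real (Suc k)) \<longlongrightarrow> \<mu> T) F"
      using tendsto_add[OF lim] by fastforce
    thus ?thesis
      using tendsto_le[OF F(1) _ lim] f_translate[OF that] by simp
  qed
  \<comment> \<open>Since the mass of \<open>G\<close> is fixed, the inequality for the complement of \<open>T\<close> is the reverse one.\<close>
  have invariant_gen: "\<mu> (a <# T) = \<mu> T" if a: "a \<in> A" and T: "T \<subseteq> carrier G" for a T
  proof -
    let ?C = "carrier G - T"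
    have aG: "a \<in> carrier G" using a A by auto
    have "(a <# T) \<union> (a <# ?C) = a <# carrier G"
      using T by (auto simp: l_coset_def)
    also have "\<dots> = carrier G"
    proof
      show "a <# carrier G \<subseteq> carrier G"
        using aG by (simp add: l_coset_subset_G)
      show "carrier G \<subseteq> a <# carrier G"
      proof
        fix x assume x: "x \<in> carrier G"
        hence "x = a \<otimes> (inv a \<otimes> x)"
          using aG by (simp add: m_assoc[symmetric])
        thus "x \<in> a <# carrier G"
          using x aG by (auto simp: l_coset_def)
      qed
    qed
    finally have un: "(a <# T) \<union> (a <# ?C) = carrier G" .
    have "(a <# T) \<inter> (a <# ?C) = {}"
      using aG T by (auto simp: l_coset_def)
    hence "\<mu> (a <# T) + \<mu> (a <# ?C) = 1"
      using additive un total by metis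
    moreover have "\<mu> T + \<mu> ?C = 1"
      using additive[of T ?C] T total by (simp add: Un_absorb1)
    moreover have "\<mu> (a <# ?C) \<le> \<mu> ?C" "\<mu> (a <# T) \<le> \<mu> T"
      using le a T by auto
    ultimately show ?thesis by linarith
  qed
  have invariant: "\<forall>T \<subseteq> carrier G. \<mu> (g <# T) = \<mu> T" if "g \<in> generate G A" for g
    using that
  proof induction
    case one
    thus ?case by (simp add: lcos_mult_one)
  next
    case (incl h)
    thus ?case by (simp add: invariant_gen)
  next
    case (inv h)
    hence hG: "h \<in> carrier G" using A by auto
    show ?case
    proof (intro allI impI)
      fix T assume T: "T \<subseteq> carrier G"
      have "\<mu> (inv h <# T) = \<mu> (h <# (inv h <# T))"
        using invariant_gen inv T hG by (simp add: l_coset_subset_G)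
      thus "\<mu> (inv h <# T) = \<mu> T"
        using T hG by (simp add: lcos_m_assoc lcos_mult_one)
    qed
  next
    case (eng g h)
    hence "g \<in> carrier G" "h \<in> carrier G" using gen by auto
    thus ?case
      using eng.IH by (simp add: lcos_m_assoc[symmetric] l_coset_subset_G)
  qed
  show ?thesis
    unfolding amenable_def
    using nonneg total additive invariant gen by (intro exI[of _ \<mu>]) auto
qed

corollary nonamenable_expansion:
  fixes G (structure)
  assumes "group G" "finite A" "A \<subseteq> carrier G" "generate G A = carrier G" "\<not> amenable G"
  obtains \<epsilon> :: real where "\<epsilon> > 0"
    "\<And>S. S \<subseteq> carrier G \<Longrightarrow> finite S \<Longrightarrow> (1 + \<epsilon>) * card S \<le> card (S <#> insert \<one> A)"
  using amenable_if_no_expansion[OF assms(1-4)] assms(5) by (meson not_le)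

section \<open>Balls and deep elements\<close>

context group
begin

lemma word_value_closed: "set w \<subseteq> carrier G \<Longrightarrow> word_value G w \<in> carrier G"
  by (induction w) (auto simp: word_value_def)

lemma word_value_append:
  "set u \<subseteq> carrier G \<Longrightarrow> set v \<subseteq> carrier G \<Longrightarrow>
    word_value G (u @ v) = word_value G u \<otimes> word_value G v"
proof (induction u)
  case Nil
  thus ?case using word_value_closed[of v] by (simp add: word_value_def)
next
  case (Cons a u)
  thus ?case
    using word_value_closed[of u] word_value_closed[of v] by (simp add: word_value_def m_assoc)
qed

lemma set_word_subset_carrier:
  "A \<subseteq> carrier G \<Longrightarrow> w \<in> words_over G A \<Longrightarrow> set w \<subseteq> carrier G"
  by (auto simp: words_over_def)

lemma generated_by_words:
  assumes A: "A \<subseteq> carrier G" and "g \<in> generate G A"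
  shows "\<exists>w \<in> words_over G A. word_value G w = g"
  using assms(2)
proof induction
  case one
  show ?case by (intro bexI[of _ "[]"]) (auto simp: word_value_def words_over_def)
next
  case (incl h)
  thus ?case using A by (intro bexI[of _ "[h]"]) (auto simp: word_value_def words_over_def)
next
  case (inv h)
  thus ?case using A by (intro bexI[of _ "[inv h]"]) (auto simp: word_value_def words_over_def)
next
  case (eng g h)
  then obtain u v where uv: "u \<in> words_over G A" "word_value G u = g"
    "v \<in> words_over G A" "word_value G v = h" by auto
  hence "word_value G (u @ v) = g \<otimes> h"
    using A by (simp add: word_value_append set_word_subset_carrier)
  moreover have "u @ v \<in> words_over G A"
    using uv by (simp add: words_over_def)
  ultimately show ?case by blast
qed

lemma word_dist_right_mult_le:
  assumes "A \<subseteq> carrier G" "g \<in> carrier G" "w \<in> words_over G A"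
  shows "word_dist G A g (g \<otimes> word_value G w) \<le> length w"
proof -
  have "word_value G w \<in> carrier G"
    by (rule word_value_closed[OF set_word_subset_carrier[OF assms(1,3)]])
  hence "word_value G w = inv g \<otimes> (g \<otimes> word_value G w)"
    using assms by (simp add: m_assoc[symmetric])
  thus ?thesis
    unfolding word_dist_def using assms by (intro Least_le) auto
qed

lemma word_ball_word:
  assumes "A \<subseteq> carrier G" "generate G A = carrier G" "g \<in> word_ball G A n"
  shows "\<exists>w \<in> words_over G A. length w \<le> n \<and> word_value G w = g"
proof -
  have g: "g \<in> carrier G" "word_dist G A \<one> g \<le> n"
    using assms(3) by (auto simp: word_ball_def)
  let ?P = "\<lambda>l. \<exists>w \<in> words_over G A. length w = l \<and> word_value G w = inv \<one> \<otimes> g"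
  have "\<exists>l. ?P l"
    using generated_by_words[of A g] assms g by auto
  hence "?P (word_dist G A \<one> g)"
    unfolding word_dist_def by (rule LeastI_ex)
  then obtain w where "w \<in> words_over G A" "length w = word_dist G A \<one> g" "word_value G w = g"
    using g by auto
  thus ?thesis using g by metis
qed

lemma finite_word_ball:
  assumes "finite A" "A \<subseteq> carrier G" "generate G A = carrier G"
  shows "finite (word_ball G A n)"
proof (rule finite_subset)
  let ?W = "{w. set w \<subseteq> A \<union> m_inv G ` A \<and> length w \<le> n}"
  show "word_ball G A n \<subseteq> word_value G ` ?W"
    using word_ball_word[OF assms(2,3)] by (fastforce simp: words_over_def)
  show "finite (word_value G ` ?W)"
    using \<open>finite A\<close> by (intro finite_imageI finite_lists_length_le) simp
qed

text \<open>
  The depth is an infimum over the complement of the ball, so an element closer than \<open>m\<close> cannot be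
  in that complement. If the complement is empty, the depth is infinite and the conclusion is trivial.
\<close>

lemma deep_element_neighbours:
  assumes "g \<in> deep_elements G A m" "h \<in> carrier G" "word_dist G A g h < m"
  shows "h \<in> word_ball G A (word_dist G A \<one> g)"
proof (rule ccontr)
  assume "h \<notin> word_ball G A (word_dist G A \<one> g)"
  hence "depth G A g \<le> enat (word_dist G A g h)"
    unfolding depth_def using assms by (intro INF_lower) auto
  moreover have "enat m \<le> depth G A g"
    using assms by (simp add: deep_elements_def)
  ultimately have "enat m \<le> enat (word_dist G A g h)" by (rule order_trans[rotated])
  thus False using assms by simp
qed

end

section \<open>Thickenings and the density of deep elements\<close>

definition thicken :: "('a, 'b) monoid_scheme \<Rightarrow> 'a set \<Rightarrow> nat \<Rightarrow> 'a set \<Rightarrow> 'a set" where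
  "thicken G B k S = ((\<lambda>T. T <#>\<^bsub>G\<^esub> B) ^^ k) S"

lemma thicken_0 [simp]: "thicken G B 0 S = S"
  and thicken_Suc [simp]: "thicken G B (Suc k) S = thicken G B k S <#>\<^bsub>G\<^esub> B"
  by (simp_all add: thicken_def)

context group
begin

lemma thicken_word:
  assumes A: "A \<subseteq> carrier G" and S: "S \<subseteq> carrier G" and "h \<in> thicken G (insert \<one> A) k S"
  shows "\<exists>g \<in> S. \<exists>w \<in> words_over G A. length w \<le> k \<and> h = g \<otimes> word_value G w"
  using assms(3)
proof (induction k arbitrary: h)
  case 0
  thus ?case
    using S by (intro bexI[of _ h] bexI[of _ "[]"]) (auto simp: word_value_def words_over_def)
next
  case (Suc k)
  then obtain h' a where h': "h' \<in> thicken G (insert \<one> A) k S" and a: "a \<in> insert \<one> A"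
    and h: "h = h' \<otimes> a"
    by (auto simp: set_mult_def)
  obtain g w where gw: "g \<in> S" "w \<in> words_over G A" "length w \<le> k" "h' = g \<otimes> word_value G w"
    using Suc.IH[OF h'] by auto
  have w: "set w \<subseteq> carrier G"
    using gw A by (simp add: set_word_subset_carrier)
  have gG: "g \<in> carrier G" "word_value G w \<in> carrier G"
    using gw S w word_value_closed by auto
  show ?case
  proof (cases "a = \<one>")
    case True
    thus ?thesis using gw w gG h by (intro bexI[of _ g] bexI[of _ w]) auto
  next
    case False
    hence "a \<in> A" "a \<in> carrier G" using a A by auto
    moreover from this have "h = g \<otimes> word_value G (w @ [a])"
      using gw w gG h by (simp add: word_value_append) (simp add: word_value_def m_assoc)
    ultimately show ?thesis
      using gw by (intro bexI[of _ g] bexI[of _ "w @ [a]"]) (auto simp: words_over_def)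
  qed
qed

lemma thicken_closed:
  "B \<subseteq> carrier G \<Longrightarrow> S \<subseteq> carrier G \<Longrightarrow> thicken G B k S \<subseteq> carrier G"
  by (induction k) (auto simp: set_mult_closed)

lemma finite_thicken: "finite B \<Longrightarrow> finite S \<Longrightarrow> finite (thicken G B k S)"
  by (induction k) (auto simp: set_mult_def)

lemma thicken_growth:
  fixes \<epsilon> :: real
  assumes expansion: "\<And>T. T \<subseteq> carrier G \<Longrightarrow> finite T \<Longrightarrow> (1 + \<epsilon>) * card T \<le> card (T <#> B)"
    and "\<epsilon> > 0" "finite B" "B \<subseteq> carrier G" "finite S" "S \<subseteq> carrier G"
  shows "(1 + \<epsilon>) ^ k * card S \<le> card (thicken G B k S)"
proof (induction k)
  case 0
  show ?case by simp
next
  case (Suc k)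
  have "(1 + \<epsilon>) ^ Suc k * card S = (1 + \<epsilon>) * ((1 + \<epsilon>) ^ k * card S)"
    by simp
  also have "\<dots> \<le> (1 + \<epsilon>) * card (thicken G B k S)"
    using Suc \<open>\<epsilon> > 0\<close> by (intro mult_left_mono) auto
  also have "\<dots> \<le> card (thicken G B (Suc k) S)"
    using expansion[OF thicken_closed finite_thicken] assms by simp
  finally show ?case .
qed

text \<open>
  Elements of the thickening are within distance \<open>k < m\<close> of an element \<open>g\<close> of depth at least \<open>m\<close>.
  They stay inside the ball whose radius is the length of \<open>g\<close>, and that radius is at most \<open>n\<close>.
\<close>

lemma thickening_deep_subset_ball:
  assumes A: "A \<subseteq> carrier G" and "k < m"
  shows "thicken G (insert \<one> A) k (word_ball G A n \<inter> deep_elements G A m) \<subseteq> word_ball G A n"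
proof
  fix h assume h: "h \<in> thicken G (insert \<one> A) k (word_ball G A n \<inter> deep_elements G A m)"
  have "word_ball G A n \<inter> deep_elements G A m \<subseteq> carrier G"
    by (auto simp: word_ball_def)
  from thicken_word[OF A this h] obtain g w where g: "g \<in> word_ball G A n" "g \<in> deep_elements G A m"
    and w: "w \<in> words_over G A" "length w \<le> k" and hgw: "h = g \<otimes> word_value G w"
    by auto
  have gG: "g \<in> carrier G" using g by (auto simp: word_ball_def)
  hence "h \<in> carrier G"
    using hgw word_value_closed[OF set_word_subset_carrier[OF A w(1)]] by simp
  moreover have "word_dist G A g h < m"
    using word_dist_right_mult_le[OF A gG w(1)] w hgw \<open>k < m\<close> by simp
  ultimately have "h \<in> word_ball G A (word_dist G A \<one> g)"
    using deep_element_neighbours g by blast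
  thus "h \<in> word_ball G A n"
    using g by (auto simp: word_ball_def)
qed

end

theorem theorem5:
  fixes G :: "('a, 'b) monoid_scheme" and A :: "'a set"
  assumes "group G"
    and "\<not> amenable G"
    and "finite A" and "A \<subseteq> carrier G" and "generate G A = carrier G"
  shows "\<exists>c b :: real. 0 < c \<and> 0 < b \<and> b < 1 \<and>
    (\<forall>m::nat. limsup (\<lambda>n. ereal (real (card (word_ball G A n \<inter> deep_elements G A m))
                              / real (card (word_ball G A n))))
              < ereal (c * b ^ m))"
proof -
  interpret group G by fact
  obtain \<epsilon> :: real where \<epsilon>: "\<epsilon> > 0" and expansion: "\<And>S. S \<subseteq> carrier G \<Longrightarrow> finite S \<Longrightarrow>
      (1 + \<epsilon>) * card S \<le> card (S <#>\<^bsub>G\<^esub> insert \<one>\<^bsub>G\<^esub> A)"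
    using nonamenable_expansion assms by metis
  define q where "q = 1 + \<epsilon>"
  have q: "q > 1" using \<epsilon> by (simp add: q_def)
  have ratio: "real (card (word_ball G A n \<inter> deep_elements G A m)) / card (word_ball G A n)
      \<le> q * (1 / q) ^ m" for n m
  proof -
    let ?S = "word_ball G A n \<inter> deep_elements G A m"
    have fin: "finite (word_ball G A n)"
      using finite_word_ball assms by simp
    have bound: "q ^ (m - 1) * card ?S \<le> card (word_ball G A n)"
    proof (cases "m = 0")
      case True
      thus ?thesis using fin by (simp add: card_mono)
    next
      case False
      have "q ^ (m - 1) * card ?S \<le> card (thicken G (insert \<one>\<^bsub>G\<^esub> A) (m - 1) ?S)"
        unfolding q_def using expansion \<epsilon> fin assms(3,4)
        by (intro thicken_growth) (auto simp: word_ball_def)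
      also have "\<dots> \<le> card (word_ball G A n)"
        using False fin assms(4) by (intro of_nat_mono card_mono thickening_deep_subset_ball) auto
      finally show ?thesis .
    qed
    \<comment> \<open>An equality except for \<open>m = 0\<close>, where the truncated exponent \<open>m - 1\<close> is \<open>0\<close>.\<close>
    have "q ^ m \<le> q * q ^ (m - 1)"
      using q by (cases m) auto
    hence "q ^ m * card ?S \<le> q * (q ^ (m - 1) * card ?S)"
      by (metis mult.assoc mult_right_mono of_nat_0_le_iff)
    also have "\<dots> \<le> q * card (word_ball G A n)"
      using bound q by simp
    finally have main: "q ^ m * card ?S \<le> q * card (word_ball G A n)" .
    show ?thesis
    proof (cases "card (word_ball G A n) = 0")
      case True
      thus ?thesis using q by simp
    next
      case False
      thus ?thesis using main q by (simp add: field_simps)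
    qed
  qed
  show ?thesis
  proof (intro exI conjI allI)
    show "0 < 2 * q" "0 < 1 / q" "1 / q < 1" using q by auto
    fix m
    have "limsup (\<lambda>n. ereal (real (card (word_ball G A n \<inter> deep_elements G A m))
        / real (card (word_ball G A n)))) \<le> ereal (q * (1 / q) ^ m)"
      by (rule Limsup_bounded) (simp add: ratio)
    also have "\<dots> < ereal (2 * q * (1 / q) ^ m)"
      using q by simp
    finally show "limsup (\<lambda>n. ereal (real (card (word_ball G A n \<inter> deep_elements G A m))
        / real (card (word_ball G A n)))) < ereal (2 * q * (1 / q) ^ m)" .
  qed
qed

end
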